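(* Let $n\ge1$ and let $S\in\{\mathcal{CT}_n,\mathcal{OCT}_n,\mathcal{ORCT}_n\}$. Then $S$ is left abundant.
   Context: $[n]=\{1,\ldots,n\}$. $\mathcal{CT}_n$ is the semigroup, under composition (maps written on the right), of all $\alpha:[n]\to[n]$ with $|x\alpha-y\alpha|\le|x-y|$ for all $x,y$. $\mathcal{OCT}_n$ is its subsemigroup of order preserving maps ($x\le y\Rightarrow x\alpha\le y\alpha$), and $\mathcal{ORCT}_n$ its subsemigroup of maps that are order preserving or order reversing ($x\le y\Rightarrow x\alpha\ge y\alpha$). On a semigroup $S$, $a\,\mathcal L^*\,b$ means: for all $x,y\in S^1$, $ax=ay$ if and only if $bx=by$. $S$ is left abundant if every $\mathcal L^*$-class of $S$ contains an idempotent. *)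

theory Defs
  imports "HOL-Library.FuncSet"
begin

text \<open>A semigroup is given by a carrier set \<open>S\<close> and a binary operation \<open>m\<close>.\<close>

definition semigroup_on :: "'a set \<Rightarrow> ('a \<Rightarrow> 'a \<Rightarrow> 'a) \<Rightarrow> bool" where
  "semigroup_on S m \<longleftrightarrow>
     (\<forall>a\<in>S. \<forall>b\<in>S. m a b \<in> S) \<and>
     (\<forall>a\<in>S. \<forall>b\<in>S. \<forall>c\<in>S. m (m a b) c = m a (m b c))"

definition has_identity :: "'a set \<Rightarrow> ('a \<Rightarrow> 'a \<Rightarrow> 'a) \<Rightarrow> bool" where
  "has_identity S m \<longleftrightarrow> (\<exists>e\<in>S. \<forall>a\<in>S. m e a = a \<and> m a e = a)"

text \<open>The monoid \<open>S\<^sup>1\<close>: elements of \<open>S\<close> are tagged with \<^const>\<open>Some\<close>, and \<^const>\<open>None\<close> is the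
  identity adjoined when (and only when) \<open>S\<close> has none.\<close>

definition adjoin_one :: "'a set \<Rightarrow> ('a \<Rightarrow> 'a \<Rightarrow> 'a) \<Rightarrow> 'a option set" where
  "adjoin_one S m = Some ` S \<union> (if has_identity S m then {} else {None})"

fun mult_one :: "('a \<Rightarrow> 'a \<Rightarrow> 'a) \<Rightarrow> 'a option \<Rightarrow> 'a option \<Rightarrow> 'a option" where
  "mult_one m None y = y"
| "mult_one m (Some a) None = Some a"
| "mult_one m (Some a) (Some b) = Some (m a b)"

definition Lstar :: "'a set \<Rightarrow> ('a \<Rightarrow> 'a \<Rightarrow> 'a) \<Rightarrow> 'a rel" where
  "Lstar S m = {(a, b). a \<in> S \<and> b \<in> S \<and>
     (\<forall>x\<in>adjoin_one S m. \<forall>y\<in>adjoin_one S m.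
        mult_one m (Some a) x = mult_one m (Some a) y \<longleftrightarrow>
        mult_one m (Some b) x = mult_one m (Some b) y)}"

lemma equiv_Lstar: "equiv S (Lstar S m)"
  unfolding Lstar_def by (intro equivI refl_onI symI transI) auto

definition left_abundant :: "'a set \<Rightarrow> ('a \<Rightarrow> 'a \<Rightarrow> 'a) \<Rightarrow> bool" where
  "left_abundant S m \<longleftrightarrow> (\<forall>C \<in> S // Lstar S m. \<exists>e\<in>C. m e e = e)"

text \<open>Self-maps of \<open>{1..n}\<close> are represented by extensional functions, so that HOL equality is
  equality of maps on \<open>{1..n}\<close>.\<close>

definition CT :: "nat \<Rightarrow> (nat \<Rightarrow> nat) set" where
  "CT n = {\<alpha> \<in> {1..n} \<rightarrow>\<^sub>E {1..n}. \<forall>x\<in>{1..n}. \<forall>y\<in>{1..n}.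
     \<bar>int (\<alpha> x) - int (\<alpha> y)\<bar> \<le> \<bar>int x - int y\<bar>}"

definition OCT :: "nat \<Rightarrow> (nat \<Rightarrow> nat) set" where
  "OCT n = {\<alpha> \<in> CT n. mono_on {1..n} \<alpha>}"

definition ORCT :: "nat \<Rightarrow> (nat \<Rightarrow> nat) set" where
  "ORCT n = {\<alpha> \<in> CT n. mono_on {1..n} \<alpha> \<or> antimono_on {1..n} \<alpha>}"

text \<open>Maps are written on the right: the product \<open>\<alpha>\<beta>\<close> applies \<open>\<alpha>\<close> first, whereas
  \<^const>\<open>compose\<close> applies its last argument first.\<close>

definition tmult :: "nat \<Rightarrow> (nat \<Rightarrow> nat) \<Rightarrow> (nat \<Rightarrow> nat) \<Rightarrow> (nat \<Rightarrow> nat)" where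
  "tmult n \<alpha> \<beta> = compose {1..n} \<beta> \<alpha>"

lemma tmult_apply: "x \<in> {1..n} \<Longrightarrow> tmult n \<alpha> \<beta> x = \<beta> (\<alpha> x)"
  by (simp add: tmult_def compose_def)

lemma CT_mapsto: "\<alpha> \<in> CT n \<Longrightarrow> x \<in> {1..n} \<Longrightarrow> \<alpha> x \<in> {1..n}"
  unfolding CT_def by blast

lemma tmult_CT:
  assumes "\<alpha> \<in> CT n" "\<beta> \<in> CT n"
  shows "tmult n \<alpha> \<beta> \<in> CT n"
proof -
  have "\<bar>int (\<beta> (\<alpha> x)) - int (\<beta> (\<alpha> y))\<bar> \<le> \<bar>int x - int y\<bar>"
    if "x \<in> {1..n}" "y \<in> {1..n}" for x y
  proof -
    have "\<bar>int (\<beta> (\<alpha> x)) - int (\<beta> (\<alpha> y))\<bar> \<le> \<bar>int (\<alpha> x) - int (\<alpha> y)\<bar>"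
      using assms CT_mapsto[OF assms(1)] that unfolding CT_def by blast
    also have "\<dots> \<le> \<bar>int x - int y\<bar>"
      using assms that unfolding CT_def by blast
    finally show ?thesis .
  qed
  moreover have "tmult n \<alpha> \<beta> \<in> {1..n} \<rightarrow>\<^sub>E {1..n}"
    using CT_mapsto[OF assms(1)] CT_mapsto[OF assms(2)]
    by (intro PiE_I) (simp_all add: tmult_def compose_def del: atLeastAtMost_iff)
  ultimately show ?thesis
    by (simp add: CT_def tmult_apply del: atLeastAtMost_iff)
qed

lemma tmult_assoc:
  assumes "\<alpha> \<in> CT n"
  shows "tmult n (tmult n \<alpha> \<beta>) \<gamma> = tmult n \<alpha> (tmult n \<beta> \<gamma>)"
  using CT_mapsto[OF assms]
  by (auto simp: tmult_def compose_def fun_eq_iff simp del: atLeastAtMost_iff)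

lemma semigroup_CT: "semigroup_on (CT n) (tmult n)"
  by (simp add: semigroup_on_def tmult_CT tmult_assoc)

lemma semigroup_OCT: "semigroup_on (OCT n) (tmult n)"
proof -
  have "tmult n \<alpha> \<beta> \<in> OCT n" if "\<alpha> \<in> OCT n" "\<beta> \<in> OCT n" for \<alpha> \<beta>
    using that CT_mapsto[of \<alpha> n] tmult_CT[of \<alpha> n \<beta>]
    by (simp add: OCT_def monotone_on_def tmult_apply del: atLeastAtMost_iff)
  then show ?thesis
    by (simp add: semigroup_on_def OCT_def tmult_assoc)
qed

lemma semigroup_ORCT: "semigroup_on (ORCT n) (tmult n)"
proof -
  have "tmult n \<alpha> \<beta> \<in> ORCT n" if "\<alpha> \<in> ORCT n" "\<beta> \<in> ORCT n" for \<alpha> \<beta>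
    using that CT_mapsto[of \<alpha> n] tmult_CT[of \<alpha> n \<beta>]
    by (auto simp add: ORCT_def monotone_on_def tmult_apply simp del: atLeastAtMost_iff)
  then show ?thesis
    by (simp add: semigroup_on_def ORCT_def tmult_assoc)
qed

end

theory Submission
  imports Defs
begin

text \<open>The image of a contraction \<open>\<alpha>\<close> of \<open>[n]\<close> is an interval \<open>[p, q]\<close>, by discrete continuity.
  Clamping to \<open>[p, q]\<close> is an order preserving idempotent contraction with the same image as
  \<open>\<alpha>\<close>. Since \<open>\<alpha>x = \<alpha>y\<close> just says that \<open>x\<close> and \<open>y\<close> agree on the image of \<open>\<alpha>\<close>, maps with
  equal images are \<open>\<L>\<^sup>*\<close>-related.\<close>

text \<open>Neighbouring points have images at most 1 apart, so walking between \<open>a\<close> and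
  \<open>b\<close> cannot skip a value.\<close>

lemma CT_intermediate_value:
  assumes "\<alpha> \<in> CT n" "a \<in> {1..n}" "b \<in> {1..n}" "\<alpha> a \<le> k" "k \<le> \<alpha> b"
  shows "k \<in> \<alpha> ` {1..n}"
proof -
  have step: "\<bar>int (\<alpha> (Suc i)) - int (\<alpha> i)\<bar> \<le> 1" if "1 \<le> i" "i < n" for i
  proof -
    have "\<bar>int (\<alpha> (Suc i)) - int (\<alpha> i)\<bar> \<le> \<bar>int (Suc i) - int i\<bar>"
      using assms(1) that unfolding CT_def by (metis (lifting) CollectD Suc_leI atLeastAtMost_iff
        le_SucI less_imp_le_nat)
    then show ?thesis by simp
  qed
  show ?thesis
  proof (cases "a \<le> b")
    case True
    have "\<exists>i. a \<le> i \<and> i \<le> b \<and> int (\<alpha> i) = int k"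
      using True assms step by (intro nat_intermed_int_val) auto
    then show ?thesis using assms by force
  next
    case False
    \<comment> \<open>From \<open>b\<close> up to \<open>a\<close> the values start above
      \<open>k\<close> and end below it; negation restores the order that the discrete intermediate
      value theorem expects.\<close>
    have "\<exists>i. b \<le> i \<and> i \<le> a \<and> - int (\<alpha> i) = - int k"
      using False assms step by (intro nat_intermed_int_val) (auto simp: abs_minus_commute)
    then show ?thesis using assms by force
  qed
qed

lemma CT_image_interval:
  assumes "n \<ge> 1" "\<alpha> \<in> CT n"
  obtains p q where "1 \<le> p" "p \<le> q" "q \<le> n" "\<alpha> ` {1..n} = {p..q}"
proof -
  let ?I = "\<alpha> ` {1..n}"
  have fin: "finite ?I" "?I \<noteq> {}" using assms(1) by auto
  have sub: "?I \<subseteq> {1..n}" using CT_mapsto[OF assms(2)] by blast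
  obtain a where a: "a \<in> {1..n}" "Min ?I = \<alpha> a" using Min_in[OF fin] by blast
  obtain b where b: "b \<in> {1..n}" "Max ?I = \<alpha> b" using Max_in[OF fin] by blast
  have "?I \<subseteq> {Min ?I..Max ?I}" using fin by auto
  moreover have "{Min ?I..Max ?I} \<subseteq> ?I"
    using CT_intermediate_value[OF assms(2) a(1) b(1)] a(2) b(2) by auto
  ultimately have eq: "?I = {Min ?I..Max ?I}" by blast
  have "1 \<le> Min ?I" using Min_in[OF fin] sub by auto
  moreover have "Max ?I \<le> n" using Max_in[OF fin] sub by auto
  moreover have "Min ?I \<le> Max ?I" using fin by simp
  ultimately show ?thesis using that eq by blast
qed

definition clamp_map :: "nat \<Rightarrow> nat \<Rightarrow> nat \<Rightarrow> nat \<Rightarrow> nat" where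
  "clamp_map n p q = restrict (\<lambda>x. max p (min q x)) {1..n}"

lemma clamp_map_OCT:
  assumes "1 \<le> p" "p \<le> q" "q \<le> n"
  shows "clamp_map n p q \<in> OCT n"
proof -
  have "\<bar>int (max p (min q x)) - int (max p (min q y))\<bar> \<le> \<bar>int x - int y\<bar>" for x y
    by linarith
  moreover have "max p (min q x) \<le> max p (min q y)" if "x \<le> y" for x y
    using that by linarith
  ultimately show ?thesis
    using assms by (auto simp: OCT_def CT_def clamp_map_def monotone_on_def)
qed

lemma clamp_map_image:
  assumes "1 \<le> p" "p \<le> q" "q \<le> n"
  shows "clamp_map n p q ` {1..n} = {p..q}"
proof
  show "clamp_map n p q ` {1..n} \<subseteq> {p..q}"
    using assms by (auto simp: clamp_map_def)
  show "{p..q} \<subseteq> clamp_map n p q ` {1..n}"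
  proof
    fix k assume "k \<in> {p..q}"
    then have "clamp_map n p q k = k" "k \<in> {1..n}" using assms by (auto simp: clamp_map_def)
    then show "k \<in> clamp_map n p q ` {1..n}" by force
  qed
qed

lemma clamp_map_idem:
  assumes "1 \<le> p" "p \<le> q" "q \<le> n"
  shows "tmult n (clamp_map n p q) (clamp_map n p q) = clamp_map n p q"
  using assms by (auto simp: tmult_def compose_def clamp_map_def fun_eq_iff)

text \<open>As \<alpha> acts first, the right factor is evaluated only on the image of \<alpha>;
  outside \<open>{1..n}\<close> both products are undefined.\<close>

lemma tmult_eq_iff:
  "tmult n \<alpha> \<beta> = tmult n \<alpha> \<gamma> \<longleftrightarrow> (\<forall>k \<in> \<alpha> ` {1..n}. \<beta> k = \<gamma> k)"
  by (auto simp: tmult_def compose_def fun_eq_iff)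

text \<open>This ensures that no \<open>None\<close> is adjoined, so testing \<open>Lstar\<close>
  involves only products of maps in \<open>S\<close>.\<close>

lemma has_identity_tmult:
  assumes "n \<ge> 1" "OCT n \<subseteq> S" "S \<subseteq> CT n"
  shows "has_identity S (tmult n)"
  unfolding has_identity_def
proof (intro bexI ballI)
  \<comment> \<open>Clamping to all of \<open>{1..n}\<close> is the identity map.\<close>
  show "clamp_map n 1 n \<in> S" using clamp_map_OCT[of 1 n n] assms by auto
  fix \<alpha> assume "\<alpha> \<in> S"
  then have "\<alpha> \<in> {1..n} \<rightarrow>\<^sub>E {1..n}" using assms(3) by (auto simp: CT_def)
  then have "\<alpha> x \<in> {1..n}" if "x \<in> {1..n}" for x using that by blast
  moreover have "clamp_map n 1 n x = x" if "x \<in> {1..n}" for x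
    using that by (simp add: clamp_map_def)
  moreover have "\<alpha> x = undefined" if "x \<notin> {1..n}" for x
    using \<open>\<alpha> \<in> {1..n} \<rightarrow>\<^sub>E {1..n}\<close> that by (rule PiE_arb)
  ultimately show "tmult n (clamp_map n 1 n) \<alpha> = \<alpha> \<and> tmult n \<alpha> (clamp_map n 1 n) = \<alpha>"
    by (simp add: tmult_def compose_def fun_eq_iff del: atLeastAtMost_iff)
qed

lemma Lstar_if_image_eq:
  assumes "has_identity S (tmult n)" "\<alpha> \<in> S" "\<beta> \<in> S" "\<alpha> ` {1..n} = \<beta> ` {1..n}"
  shows "(\<alpha>, \<beta>) \<in> Lstar S (tmult n)"
proof -
  have "tmult n \<alpha> x = tmult n \<alpha> y \<longleftrightarrow> tmult n \<beta> x = tmult n \<beta> y" for x y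
    unfolding tmult_eq_iff assms(4) ..
  then show ?thesis
    using assms by (simp add: Lstar_def adjoin_one_def)
qed

text \<open>The upper bound \<open>CT n\<close> makes images intervals; the lower bound
  \<open>OCT n\<close> puts the clamping maps, hence the required idempotents, into
  \<open>S\<close>. This treats the three semigroups at once.\<close>

lemma left_abundant_between:
  assumes "n \<ge> 1" "OCT n \<subseteq> S" "S \<subseteq> CT n"
  shows "left_abundant S (tmult n)"
  unfolding left_abundant_def
proof
  fix C assume "C \<in> S // Lstar S (tmult n)"
  then obtain \<alpha> where \<alpha>: "\<alpha> \<in> S" "C = Lstar S (tmult n) `` {\<alpha>}" by (rule quotientE)
  obtain p q where pq: "1 \<le> p" "p \<le> q" "q \<le> n" and im: "\<alpha> ` {1..n} = {p..q}"
    using CT_image_interval[of n \<alpha>] assms \<alpha>(1) by blast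
  have "(\<alpha>, clamp_map n p q) \<in> Lstar S (tmult n)"
    using has_identity_tmult[OF assms] \<alpha>(1) clamp_map_OCT[OF pq] assms(2)
      clamp_map_image[OF pq] im
    by (intro Lstar_if_image_eq) auto
  then show "\<exists>e\<in>C. tmult n e e = e"
    using \<alpha>(2) clamp_map_idem[OF pq] by blast
qed

theorem lemma1p19:
  fixes n :: nat and S :: "(nat \<Rightarrow> nat) set"
  assumes "n \<ge> 1" and "S \<in> {CT n, OCT n, ORCT n}"
  shows "left_abundant S (tmult n)"
  using assms by (intro left_abundant_between) (auto simp: OCT_def ORCT_def)

end
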